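(* Let $R$ be a semilocal ring, and let $P$ be a countably generated projective right $R$-module. Then $P$ is fair sized.
   Context: Rings are associative with $1$. A ring $R$ is semilocal if $R/J(R)$ is semisimple artinian, where $J(R)$ is the Jacobson radical. For a right $R$-module $M$, let $\mathcal{I}(M)$ be the set of two-sided ideals $I$ of $R$ such that $M/MI$ is finitely generated. A countably generated projective right $R$-module $P$ is fair sized if $\mathcal{I}(P)$ has a minimal element with respect to inclusion. *)

theory Defs
  imports "HOL-Algebra.QuotRing" "HOL-Library.Countable_Set"
begin

section \<open>Right modules over a not necessarily commutative ring\<close>

text \<open>
  The library's locale \<open>module\<close> requires a commutative base ring. As in the library's record of
  the same name, the multiplicative fields inherited from \<^typ>\<open>'b ring\<close> play no role.
\<close>

record ('a, 'b) rmod = "'b ring" +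
  ract :: "['b, 'a] \<Rightarrow> 'b" (infixl \<open>\<triangleleft>\<index>\<close> 70)

locale right_module = R?: ring R + M?: abelian_group M
  for R :: "('a, 'm) ring_scheme" (structure) and M :: "('a, 'b, 'n) rmod_scheme" (structure) +
  assumes ract_closed [simp, intro]:
      "\<lbrakk>x \<in> carrier M; r \<in> carrier R\<rbrakk> \<Longrightarrow> x \<triangleleft>\<^bsub>M\<^esub> r \<in> carrier M"
    and ract_add_scalar:
      "\<lbrakk>x \<in> carrier M; r \<in> carrier R; s \<in> carrier R\<rbrakk>
        \<Longrightarrow> x \<triangleleft>\<^bsub>M\<^esub> (r \<oplus> s) = x \<triangleleft>\<^bsub>M\<^esub> r \<oplus>\<^bsub>M\<^esub> x \<triangleleft>\<^bsub>M\<^esub> s"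
    and ract_add:
      "\<lbrakk>x \<in> carrier M; y \<in> carrier M; r \<in> carrier R\<rbrakk>
        \<Longrightarrow> (x \<oplus>\<^bsub>M\<^esub> y) \<triangleleft>\<^bsub>M\<^esub> r = x \<triangleleft>\<^bsub>M\<^esub> r \<oplus>\<^bsub>M\<^esub> y \<triangleleft>\<^bsub>M\<^esub> r"
    and ract_assoc:
      "\<lbrakk>x \<in> carrier M; r \<in> carrier R; s \<in> carrier R\<rbrakk>
        \<Longrightarrow> x \<triangleleft>\<^bsub>M\<^esub> (r \<otimes> s) = (x \<triangleleft>\<^bsub>M\<^esub> r) \<triangleleft>\<^bsub>M\<^esub> s"
    and ract_one [simp]:
      "x \<in> carrier M \<Longrightarrow> x \<triangleleft>\<^bsub>M\<^esub> \<one> = x"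

definition right_submodule ::
    "('a, 'm) ring_scheme \<Rightarrow> 'b set \<Rightarrow> ('a, 'b, 'n) rmod_scheme \<Rightarrow> bool" where
  "right_submodule R N M \<longleftrightarrow>
     additive_subgroup N M \<and> (\<forall>x\<in>N. \<forall>r\<in>carrier R. x \<triangleleft>\<^bsub>M\<^esub> r \<in> N)"

definition right_span ::
    "('a, 'm) ring_scheme \<Rightarrow> ('a, 'b, 'n) rmod_scheme \<Rightarrow> 'b set \<Rightarrow> 'b set" where
  "right_span R M S = \<Inter>{N. right_submodule R N M \<and> S \<subseteq> N}"

definition finitely_generated ::
    "('a, 'm) ring_scheme \<Rightarrow> ('a, 'b, 'n) rmod_scheme \<Rightarrow> bool" where
  "finitely_generated R M \<longleftrightarrow>
     (\<exists>S. finite S \<and> S \<subseteq> carrier M \<and> right_span R M S = carrier M)"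

definition countably_generated ::
    "('a, 'm) ring_scheme \<Rightarrow> ('a, 'b, 'n) rmod_scheme \<Rightarrow> bool" where
  "countably_generated R M \<longleftrightarrow>
     (\<exists>S. countable S \<and> S \<subseteq> carrier M \<and> right_span R M S = carrier M)"

definition right_module_hom ::
    "('a, 'm) ring_scheme \<Rightarrow> ('a, 'b, 'n) rmod_scheme \<Rightarrow> ('a, 'c, 'k) rmod_scheme \<Rightarrow> ('b \<Rightarrow> 'c) set"
  where
  "right_module_hom R M N =
     {f. f \<in> carrier M \<rightarrow> carrier N \<and>
         (\<forall>x\<in>carrier M. \<forall>y\<in>carrier M. f (x \<oplus>\<^bsub>M\<^esub> y) = f x \<oplus>\<^bsub>N\<^esub> f y) \<and>
         (\<forall>x\<in>carrier M. \<forall>r\<in>carrier R. f (x \<triangleleft>\<^bsub>M\<^esub> r) = f x \<triangleleft>\<^bsub>N\<^esub> r)}"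

definition quotient_right_module ::
    "('a, 'b, 'n) rmod_scheme \<Rightarrow> 'b set \<Rightarrow> ('a, 'b set) rmod" where
  "quotient_right_module M N =
     \<lparr>carrier = a_rcosets\<^bsub>M\<^esub> N, monoid.mult = undefined, one = undefined,
      zero = N, add = (<+>\<^bsub>M\<^esub>),
      ract = (\<lambda>C r. \<Union>x\<in>C. N +>\<^bsub>M\<^esub> (x \<triangleleft>\<^bsub>M\<^esub> r))\<rparr>"

text \<open>The ring \<open>R\<close> as a right module over itself; its submodules are the right ideals.\<close>

definition regular_right_module :: "('a, 'm) ring_scheme \<Rightarrow> ('a, 'a) rmod" where
  "regular_right_module R =
     \<lparr>carrier = carrier R, monoid.mult = monoid.mult R, one = one R, zero = zero R, add = add R,
      ract = monoid.mult R\<rparr>"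

section \<open>Projective modules\<close>

text \<open>The free module \<open>R\<^sup>(\<^sup>S\<^sup>)\<close>: finitely supported functions, extended by zero outside \<open>S\<close>.\<close>

definition free_right_module ::
    "('a, 'm) ring_scheme \<Rightarrow> 'x set \<Rightarrow> ('a, 'x \<Rightarrow> 'a) rmod" where
  "free_right_module R S =
     \<lparr>carrier = {f. (\<forall>x\<in>S. f x \<in> carrier R) \<and> (\<forall>x. x \<notin> S \<longrightarrow> f x = \<zero>\<^bsub>R\<^esub>) \<and>
                    finite {x. f x \<noteq> \<zero>\<^bsub>R\<^esub>}},
      monoid.mult = undefined, one = undefined,
      zero = (\<lambda>x. \<zero>\<^bsub>R\<^esub>), add = (\<lambda>f g x. f x \<oplus>\<^bsub>R\<^esub> g x),
      ract = (\<lambda>f r x. f x \<otimes>\<^bsub>R\<^esub> r)\<rparr>"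

text \<open>
  Projective: isomorphic to a direct summand \<open>A\<close> of a free module \<open>F = A \<oplus> B\<close>.
  Taking the basis of \<open>F\<close> inside the element type of \<open>P\<close> loses no generality: if \<open>P\<close> is projective,
  then the canonical epimorphism onto \<open>P\<close> from the free module on \<open>carrier P\<close> splits.
\<close>

definition projective_right_module ::
    "('a, 'm) ring_scheme \<Rightarrow> ('a, 'b, 'n) rmod_scheme \<Rightarrow> bool" where
  "projective_right_module R P \<longleftrightarrow>
     (\<exists>(S :: 'b set) A B f.
        let F = free_right_module R S in
          right_submodule R A F \<and> right_submodule R B F \<and>
          A \<inter> B = {\<zero>\<^bsub>F\<^esub>} \<and> A <+>\<^bsub>F\<^esub> B = carrier F \<and>
          f \<in> right_module_hom R P F \<and> bij_betw f (carrier P) A)"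

section \<open>Semilocal rings\<close>

definition maximal_right_submodule ::
    "('a, 'm) ring_scheme \<Rightarrow> 'b set \<Rightarrow> ('a, 'b, 'n) rmod_scheme \<Rightarrow> bool" where
  "maximal_right_submodule R N M \<longleftrightarrow>
     right_submodule R N M \<and> N \<noteq> carrier M \<and>
     (\<forall>K. right_submodule R K M \<and> N \<subseteq> K \<longrightarrow> K = N \<or> K = carrier M)"

text \<open>
  The intersection of the maximal right ideals; it is the whole ring if there are none, that is,
  for the zero ring.
\<close>

definition jacobson_radical :: "('a, 'm) ring_scheme \<Rightarrow> 'a set" where
  "jacobson_radical R =
     {x \<in> carrier R. \<forall>N. maximal_right_submodule R N (regular_right_module R) \<longrightarrow> x \<in> N}"

definition simple_right_submodule ::
    "('a, 'm) ring_scheme \<Rightarrow> 'b set \<Rightarrow> ('a, 'b, 'n) rmod_scheme \<Rightarrow> bool" where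
  "simple_right_submodule R N M \<longleftrightarrow>
     right_submodule R N M \<and> N \<noteq> {\<zero>\<^bsub>M\<^esub>} \<and>
     (\<forall>K. right_submodule R K M \<and> K \<subseteq> N \<longrightarrow> K = {\<zero>\<^bsub>M\<^esub>} \<or> K = N)"

text \<open>A semisimple module is the sum of its simple submodules.\<close>

definition semisimple_right_module ::
    "('a, 'm) ring_scheme \<Rightarrow> ('a, 'b, 'n) rmod_scheme \<Rightarrow> bool" where
  "semisimple_right_module R M \<longleftrightarrow>
     right_span R M (\<Union>{N. simple_right_submodule R N M}) = carrier M"

definition artinian_right_module ::
    "('a, 'm) ring_scheme \<Rightarrow> ('a, 'b, 'n) rmod_scheme \<Rightarrow> bool" where
  "artinian_right_module R M \<longleftrightarrow>
     (\<forall>N :: nat \<Rightarrow> 'b set.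
        (\<forall>n. right_submodule R (N n) M) \<and> (\<forall>n. N (Suc n) \<subseteq> N n) \<longrightarrow>
        (\<exists>n. \<forall>m\<ge>n. N m = N n))"

definition semisimple_artinian :: "('a, 'm) ring_scheme \<Rightarrow> bool" where
  "semisimple_artinian R \<longleftrightarrow>
     semisimple_right_module R (regular_right_module R) \<and>
     artinian_right_module R (regular_right_module R)"

definition semilocal :: "('a, 'm) ring_scheme \<Rightarrow> bool" where
  "semilocal R \<longleftrightarrow> semisimple_artinian (R Quot jacobson_radical R)"

section \<open>Fair sized projective modules\<close>

definition module_times_ideal ::
    "('a, 'm) ring_scheme \<Rightarrow> ('a, 'b, 'n) rmod_scheme \<Rightarrow> 'a set \<Rightarrow> 'b set" where
  "module_times_ideal R M I = right_span R M {x \<triangleleft>\<^bsub>M\<^esub> r | x r. x \<in> carrier M \<and> r \<in> I}"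

definition fg_quotient_ideals ::
    "('a, 'm) ring_scheme \<Rightarrow> ('a, 'b, 'n) rmod_scheme \<Rightarrow> 'a set set" where
  "fg_quotient_ideals R M =
     {I. ideal I R \<and> finitely_generated R (quotient_right_module M (module_times_ideal R M I))}"

definition fair_sized ::
    "('a, 'm) ring_scheme \<Rightarrow> ('a, 'b, 'n) rmod_scheme \<Rightarrow> bool" where
  "fair_sized R P \<longleftrightarrow>
     right_module R P \<and> countably_generated R P \<and> projective_right_module R P \<and>
     (\<exists>I\<in>fg_quotient_ideals R P. \<forall>J\<in>fg_quotient_ideals R P. J \<subseteq> I \<longrightarrow> J = I)"

end

theory Submission
  imports Defs
begin

text \<open>
  \<open>\<I>(P)\<close> is closed under intersections, and \<open>R/J(R)\<close> is artinian, so some \<open>I \<in> \<I>(P)\<close> satisfies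
  \<open>I \<subseteq> K + J(R)\<close> for every \<open>K \<in> \<I>(P)\<close> contained in \<open>I\<close>. If the finite set \<open>S\<close> generates \<open>P\<close> modulo
  \<open>P I\<close>, then by Nakayama's lemma it generates \<open>P\<close> modulo \<open>P K\<close> for every \<open>K \<in> \<I>(P)\<close>. Choose
  coordinates on \<open>P\<close> as a summand of a free module. Only finitely many of them are nonzero on \<open>S\<close>; each
  of the others maps \<open>S\<close> to zero, hence \<open>P\<close> into every \<open>K \<in> \<I>(P)\<close>. The ideal generated by the values
  of these other coordinates lies in \<open>\<I>(P)\<close>, so it is the least element of \<open>\<I>(P)\<close>.
\<close>

section \<open>Submodules, spans and homomorphisms of right modules\<close>

lemma ideal_subset_carrier: "ideal I R \<Longrightarrow> I \<subseteq> carrier R"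
  by (meson additive_subgroup.a_subset ideal.axioms(1))

lemma right_submoduleD:
  assumes "right_submodule R N M"
  shows "N \<subseteq> carrier M" "\<zero>\<^bsub>M\<^esub> \<in> N"
    "\<And>x y. \<lbrakk>x \<in> N; y \<in> N\<rbrakk> \<Longrightarrow> x \<oplus>\<^bsub>M\<^esub> y \<in> N"
    "\<And>x r. \<lbrakk>x \<in> N; r \<in> carrier R\<rbrakk> \<Longrightarrow> x \<triangleleft>\<^bsub>M\<^esub> r \<in> N"
  using assms unfolding right_submodule_def
  by (auto dest: additive_subgroup.a_subset additive_subgroup.zero_closed
      additive_subgroup.a_closed)

context right_module
begin

lemma ract_zero_right [simp]: "x \<in> carrier M \<Longrightarrow> x \<triangleleft>\<^bsub>M\<^esub> \<zero> = \<zero>\<^bsub>M\<^esub>"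
  using ract_add_scalar[of x "\<zero>" "\<zero>"] M.add.l_cancel_one'[of "x \<triangleleft>\<^bsub>M\<^esub> \<zero>" "x \<triangleleft>\<^bsub>M\<^esub> \<zero>"]
  by simp

lemma ract_zero_left [simp]: "r \<in> carrier R \<Longrightarrow> \<zero>\<^bsub>M\<^esub> \<triangleleft>\<^bsub>M\<^esub> r = \<zero>\<^bsub>M\<^esub>"
  using ract_add[of "\<zero>\<^bsub>M\<^esub>" "\<zero>\<^bsub>M\<^esub>" r] M.add.l_cancel_one'[of "\<zero>\<^bsub>M\<^esub> \<triangleleft>\<^bsub>M\<^esub> r" "\<zero>\<^bsub>M\<^esub> \<triangleleft>\<^bsub>M\<^esub> r"]
  by simp

lemma ract_minus:
  assumes "x \<in> carrier M" "r \<in> carrier R"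
  shows "x \<triangleleft>\<^bsub>M\<^esub> (\<ominus> r) = \<ominus>\<^bsub>M\<^esub> (x \<triangleleft>\<^bsub>M\<^esub> r)"
proof -
  have "x \<triangleleft>\<^bsub>M\<^esub> (\<ominus> r) \<oplus>\<^bsub>M\<^esub> x \<triangleleft>\<^bsub>M\<^esub> r = \<zero>\<^bsub>M\<^esub>"
    using assms by (simp add: ract_add_scalar[symmetric] R.l_neg)
  then show ?thesis
    using assms by (simp add: M.minus_equality)
qed

text \<open>Negatives come from the action of -1, so four closure conditions suffice to get an
  additive subgroup.\<close>

lemma right_submoduleI:
  assumes "N \<subseteq> carrier M" "\<zero>\<^bsub>M\<^esub> \<in> N"
    and "\<And>x y. \<lbrakk>x \<in> N; y \<in> N\<rbrakk> \<Longrightarrow> x \<oplus>\<^bsub>M\<^esub> y \<in> N"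
    and ract: "\<And>x r. \<lbrakk>x \<in> N; r \<in> carrier R\<rbrakk> \<Longrightarrow> x \<triangleleft>\<^bsub>M\<^esub> r \<in> N"
  shows "right_submodule R N M"
proof -
  have "\<ominus>\<^bsub>M\<^esub> x \<in> N" if "x \<in> N" for x
    using ract[OF that, of "\<ominus> \<one>"] that assms(1) by (auto simp: ract_minus)
  then have "subgroup N (add_monoid M)"
    using assms by (intro M.add.subgroupI) (auto simp: a_inv_def)
  then show ?thesis
    using ract unfolding right_submodule_def by (auto intro: additive_subgroup.intro)
qed

lemma right_submodule_minus:
  assumes "right_submodule R N M" "x \<in> N" "y \<in> N"
  shows "x \<ominus>\<^bsub>M\<^esub> y \<in> N"
proof -
  have "y \<triangleleft>\<^bsub>M\<^esub> (\<ominus> \<one>) = \<ominus>\<^bsub>M\<^esub> y"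
    using right_submoduleD(1)[OF assms(1)] assms(3) by (auto simp: ract_minus)
  then have "\<ominus>\<^bsub>M\<^esub> y \<in> N"
    using right_submoduleD(4)[OF assms(1,3), of "\<ominus> \<one>"] by simp
  then show ?thesis
    using right_submoduleD(3)[OF assms(1,2)] by (simp add: a_minus_def)
qed

lemma right_submodule_carrier: "right_submodule R (carrier M) M"
  by (rule right_submoduleI) auto

lemma right_span_submodule:
  assumes "X \<subseteq> carrier M"
  shows "right_submodule R (right_span R M X) M"
proof (rule right_submoduleI)
  show "right_span R M X \<subseteq> carrier M"
    using assms right_submodule_carrier unfolding right_span_def by auto
qed (auto simp: right_span_def dest: right_submoduleD(2,3,4))

lemma right_span_incl: "X \<subseteq> right_span R M X"
  unfolding right_span_def by auto

lemma right_span_minimal: "\<lbrakk>right_submodule R N M; X \<subseteq> N\<rbrakk> \<Longrightarrow> right_span R M X \<subseteq> N"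
  unfolding right_span_def by auto

text \<open>Since \<open>I\<close> absorbs multiplication on the right and s t + s t' = s (t + t'),
  the single products s t already form a submodule, with no finite sums to take. The cases in use
  are N + sR and N + sJ with J the Jacobson radical.\<close>

lemma right_submodule_add_ract_ideal:
  assumes N: "right_submodule R N M" and I: "ideal I R" and s: "s \<in> carrier M"
  shows "right_submodule R {n \<oplus>\<^bsub>M\<^esub> s \<triangleleft>\<^bsub>M\<^esub> t | n t. n \<in> N \<and> t \<in> I} M" (is "right_submodule R ?K M")
proof (rule right_submoduleI)
  note Nc = right_submoduleD(1)[OF N, THEN subsetD]
    and Ic = ideal_subset_carrier[OF I, THEN subsetD]
  show "?K \<subseteq> carrier M"
    using s Nc Ic by auto
  show "\<zero>\<^bsub>M\<^esub> \<in> ?K"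
    using s right_submoduleD(2)[OF N] additive_subgroup.zero_closed[OF ideal.axioms(1)[OF I]]
    by (auto intro!: exI[of _ "\<zero>\<^bsub>M\<^esub>"] exI[of _ "\<zero>"])
  show "x \<oplus>\<^bsub>M\<^esub> y \<in> ?K" if xy: "x \<in> ?K" "y \<in> ?K" for x y
  proof -
    obtain n t n' t' where *: "n \<in> N" "t \<in> I" "n' \<in> N" "t' \<in> I"
      "x = n \<oplus>\<^bsub>M\<^esub> s \<triangleleft>\<^bsub>M\<^esub> t" "y = n' \<oplus>\<^bsub>M\<^esub> s \<triangleleft>\<^bsub>M\<^esub> t'"
      using xy by blast
    then have "x \<oplus>\<^bsub>M\<^esub> y = (n \<oplus>\<^bsub>M\<^esub> n') \<oplus>\<^bsub>M\<^esub> s \<triangleleft>\<^bsub>M\<^esub> (t \<oplus> t')"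
      using s Nc Ic by (simp add: ract_add_scalar M.a_ac)
    moreover have "n \<oplus>\<^bsub>M\<^esub> n' \<in> N" "t \<oplus> t' \<in> I"
      using * right_submoduleD(3)[OF N] additive_subgroup.a_closed[OF ideal.axioms(1)[OF I]]
      by auto
    ultimately show ?thesis by blast
  qed
  show "x \<triangleleft>\<^bsub>M\<^esub> r \<in> ?K" if xr: "x \<in> ?K" "r \<in> carrier R" for x r
  proof -
    obtain n t where *: "n \<in> N" "t \<in> I" "x = n \<oplus>\<^bsub>M\<^esub> s \<triangleleft>\<^bsub>M\<^esub> t"
      using xr by blast
    then have "x \<triangleleft>\<^bsub>M\<^esub> r = n \<triangleleft>\<^bsub>M\<^esub> r \<oplus>\<^bsub>M\<^esub> s \<triangleleft>\<^bsub>M\<^esub> (t \<otimes> r)"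
      using s Nc Ic xr(2) by (simp add: ract_add ract_assoc)
    moreover have "n \<triangleleft>\<^bsub>M\<^esub> r \<in> N" "t \<otimes> r \<in> I"
      using * xr(2) right_submoduleD(4)[OF N] ideal.I_r_closed[OF I] by auto
    ultimately show ?thesis by blast
  qed
qed

lemma right_module_hom_zero:
  assumes "right_module R L" and f: "f \<in> right_module_hom R M L"
  shows "f \<zero>\<^bsub>M\<^esub> = \<zero>\<^bsub>L\<^esub>"
proof -
  interpret L: right_module R L by fact
  \<comment> \<open>\<open>right_module_hom\<close> says nothing about zero, so zero is written as a
    product: f(0) = f(0 0) = f(0) 0 = 0. The simp rules that would collapse 0 0 too early are
    switched off.\<close>
  have "f \<zero>\<^bsub>M\<^esub> \<in> carrier L" "f (\<zero>\<^bsub>M\<^esub> \<triangleleft>\<^bsub>M\<^esub> \<zero>) = f \<zero>\<^bsub>M\<^esub> \<triangleleft>\<^bsub>L\<^esub> \<zero>"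
    using f by (auto simp: right_module_hom_def simp del: ract_zero_right ract_zero_left)
  then show ?thesis by simp
qed

lemma right_submodule_vimage:
  assumes "right_module R L" and f: "f \<in> right_module_hom R M L" and K: "right_submodule R K L"
  shows "right_submodule R {x \<in> carrier M. f x \<in> K} M"
proof -
  interpret L: right_module R L by fact
  have "f \<zero>\<^bsub>M\<^esub> = \<zero>\<^bsub>L\<^esub>"
    by (rule right_module_hom_zero[OF assms(1) f])
  then show ?thesis
    using f right_submoduleD[OF K]
    by (intro right_submoduleI) (auto simp: right_module_hom_def)
qed

lemma right_submodule_image:
  assumes "right_module R L" and f: "f \<in> right_module_hom R M L" and K: "right_submodule R K M"
  shows "right_submodule R (f ` K) L"
proof -
  interpret L: right_module R L by fact
  note Kc = right_submoduleD(1)[OF K, THEN subsetD]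
  have f0: "f \<zero>\<^bsub>M\<^esub> = \<zero>\<^bsub>L\<^esub>"
    by (rule right_module_hom_zero[OF assms(1) f])
  show ?thesis
  proof (rule L.right_submoduleI)
    show "f ` K \<subseteq> carrier L"
      using f Kc by (auto simp: right_module_hom_def)
    show "\<zero>\<^bsub>L\<^esub> \<in> f ` K"
      using right_submoduleD(2)[OF K] f0 by (metis imageI)
    show "x \<oplus>\<^bsub>L\<^esub> y \<in> f ` K" if xy: "x \<in> f ` K" "y \<in> f ` K" for x y
    proof -
      obtain a b where "a \<in> K" "b \<in> K" "x = f a" "y = f b" using xy by auto
      moreover from this have "x \<oplus>\<^bsub>L\<^esub> y = f (a \<oplus>\<^bsub>M\<^esub> b)"
        using f Kc by (auto simp: right_module_hom_def)
      ultimately show ?thesis using right_submoduleD(3)[OF K] by blast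
    qed
    show "x \<triangleleft>\<^bsub>L\<^esub> r \<in> f ` K" if xr: "x \<in> f ` K" "r \<in> carrier R" for x r
    proof -
      obtain a where "a \<in> K" "x = f a" using xr by auto
      moreover from this have "x \<triangleleft>\<^bsub>L\<^esub> r = f (a \<triangleleft>\<^bsub>M\<^esub> r)"
        using f Kc xr(2) by (auto simp: right_module_hom_def)
      ultimately show ?thesis using right_submoduleD(4)[OF K] xr(2) by blast
    qed
  qed
qed

section \<open>Generation modulo an ideal\<close>

text \<open>For an ideal \<open>I\<close> and \<open>S\<close> inside the carrier this is M = SR +
  MI, tested on submodules so that neither sums nor quotients have to be formed. \<open>I\<close>
  may be any set; with \<open>I = {}\<close> the notion is ordinary generation, which is how
  Nakayama's lemma uses it.\<close>

definition generates_modulo :: "'b set \<Rightarrow> 'a set \<Rightarrow> bool" where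
  "generates_modulo S I \<longleftrightarrow>
     (\<forall>N. right_submodule R N M \<and> S \<subseteq> N \<and> (\<forall>x\<in>carrier M. \<forall>r\<in>I. x \<triangleleft>\<^bsub>M\<^esub> r \<in> N)
        \<longrightarrow> carrier M \<subseteq> N)"

lemma generates_moduloD:
  assumes "generates_modulo S I" "right_submodule R N M" "S \<subseteq> N"
    and "\<And>x r. \<lbrakk>x \<in> carrier M; r \<in> I\<rbrakk> \<Longrightarrow> x \<triangleleft>\<^bsub>M\<^esub> r \<in> N"
  shows "carrier M \<subseteq> N"
  using assms unfolding generates_modulo_def by blast

lemma generates_modulo_mono:
  "\<lbrakk>generates_modulo S I; S \<subseteq> T; I \<subseteq> J\<rbrakk> \<Longrightarrow> generates_modulo T J"
  unfolding generates_modulo_def by blast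

text \<open>Multiplying M = TR + MJ by I gives MI inside TI + MJI, and JI lies in the intersection
  of I and J. So a submodule N that contains S, T and the multiples by that intersection contains MI
  as well, and then all of M = SR + MI.\<close>

lemma generates_modulo_Int:
  assumes I: "ideal I R" and J: "ideal J R" and S: "generates_modulo S I"
    and T: "generates_modulo T J" and Tc: "T \<subseteq> carrier M"
  shows "generates_modulo (S \<union> T) (I \<inter> J)"
  unfolding generates_modulo_def
proof (intro allI impI, elim conjE)
  note Ic = ideal_subset_carrier[OF I, THEN subsetD]
    and Jc = ideal_subset_carrier[OF J, THEN subsetD]
  fix N assume N: "right_submodule R N M" and ST: "S \<union> T \<subseteq> N"
    and IJ: "\<forall>x\<in>carrier M. \<forall>r\<in>I \<inter> J. x \<triangleleft>\<^bsub>M\<^esub> r \<in> N"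
  \<comment> \<open>The equation K = M says that MI lies in N. Left absorption by \<open>I\<close>
    makes K a submodule: (x r) i = x (r i).\<close>
  define K where "K = {x \<in> carrier M. \<forall>r\<in>I. x \<triangleleft>\<^bsub>M\<^esub> r \<in> N}"
  have "right_submodule R K M"
  proof (rule right_submoduleI)
    show "x \<triangleleft>\<^bsub>M\<^esub> r \<in> K" if "x \<in> K" "r \<in> carrier R" for x r
      using that ideal.I_l_closed[OF I] Ic unfolding K_def
      by (auto simp: ract_assoc[symmetric])
  qed (use right_submoduleD[OF N] Ic in \<open>auto simp: K_def ract_add\<close>)
  moreover have "T \<subseteq> K"
    using ST Tc right_submoduleD(4)[OF N] Ic by (auto simp: K_def)
  moreover have "x \<triangleleft>\<^bsub>M\<^esub> r \<in> K" if "x \<in> carrier M" "r \<in> J" for x r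
    using that IJ ideal.I_r_closed[OF J] ideal.I_l_closed[OF I] Ic Jc
    by (auto simp: K_def ract_assoc[symmetric])
  ultimately have "carrier M \<subseteq> K"
    by (rule generates_moduloD[OF T])
  then show "carrier M \<subseteq> N"
    using generates_moduloD[OF S N] ST by (auto simp: K_def)
qed

section \<open>Quotient modules and finite generation\<close>

text \<open>The action on the quotient is a union over all representatives of a coset. Two
  representatives differ by an element of N, and N absorbs the action, so every member of the union
  is the same coset.\<close>

lemma rcoset_ract:
  assumes N: "right_submodule R N M" and x: "x \<in> carrier M" and r: "r \<in> carrier R"
  shows "(\<Union>y\<in>N +>\<^bsub>M\<^esub> x. N +>\<^bsub>M\<^esub> (y \<triangleleft>\<^bsub>M\<^esub> r)) = N +>\<^bsub>M\<^esub> (x \<triangleleft>\<^bsub>M\<^esub> r)"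
proof -
  have add: "abelian_subgroup N M"
    using N by (simp add: right_submodule_def abelian_subgroupI3 M.abelian_group_axioms)
  have "N +>\<^bsub>M\<^esub> (y \<triangleleft>\<^bsub>M\<^esub> r) = N +>\<^bsub>M\<^esub> (x \<triangleleft>\<^bsub>M\<^esub> r)" if y: "y \<in> N +>\<^bsub>M\<^esub> x" for y
  proof -
    obtain n where n: "n \<in> N" "y = n \<oplus>\<^bsub>M\<^esub> x"
      using y by (auto simp: a_r_coset_def')
    have "y \<triangleleft>\<^bsub>M\<^esub> r \<in> N +>\<^bsub>M\<^esub> (x \<triangleleft>\<^bsub>M\<^esub> r)"
      using n right_submoduleD(1,4)[OF N] x r
      by (auto simp: a_r_coset_def' ract_add subset_iff)
    then show ?thesis
      using abelian_subgroup.a_repr_independence'[OF add] x r by auto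
  qed
  moreover have "x \<in> N +>\<^bsub>M\<^esub> x"
    using abelian_subgroup.a_rcos_self[OF add x] .
  ultimately show ?thesis by blast
qed

lemma quotient_simps:
  "carrier (quotient_right_module M N) = (+>\<^bsub>M\<^esub>) N ` carrier M"
  "\<zero>\<^bsub>quotient_right_module M N\<^esub> = N"
  "add (quotient_right_module M N) = (<+>\<^bsub>M\<^esub>)"
  "C \<triangleleft>\<^bsub>quotient_right_module M N\<^esub> r = (\<Union>x\<in>C. N +>\<^bsub>M\<^esub> (x \<triangleleft>\<^bsub>M\<^esub> r))"
  by (auto simp: quotient_right_module_def A_RCOSETS_def')

lemma quotient_right_module_right_module:
  assumes N: "right_submodule R N M"
  shows "right_module R (quotient_right_module M N)" (is "right_module R ?Q")
    and "(+>\<^bsub>M\<^esub>) N \<in> right_module_hom R M (quotient_right_module M N)" (is "?q \<in> _")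
proof -
  have add: "abelian_subgroup N M"
    using N by (simp add: right_submodule_def abelian_subgroupI3 M.abelian_group_axioms)
  have q_add: "?q x \<oplus>\<^bsub>?Q\<^esub> ?q y = ?q (x \<oplus>\<^bsub>M\<^esub> y)"
    if "x \<in> carrier M" "y \<in> carrier M" for x y
    using abelian_subgroup.a_rcos_sum[OF add that] by (simp add: quotient_simps)
  have q_ract: "?q x \<triangleleft>\<^bsub>?Q\<^esub> r = ?q (x \<triangleleft>\<^bsub>M\<^esub> r)"
    if "x \<in> carrier M" "r \<in> carrier R" for x r
    using rcoset_ract[OF N that] by (simp add: quotient_simps)
  have carr: "carrier ?Q = ?q ` carrier M"
    by (simp add: quotient_simps)
  show "?q \<in> right_module_hom R M ?Q"
    by (auto simp: right_module_hom_def carr q_add q_ract)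
  have q_zero: "\<zero>\<^bsub>?Q\<^esub> = ?q \<zero>\<^bsub>M\<^esub>"
    using M.a_coset_add_zero[OF right_submoduleD(1)[OF N]] by (simp add: quotient_simps)
  have "abelian_group ?Q"
  proof (rule abelian_groupI)
    show "\<exists>y\<in>carrier ?Q. y \<oplus>\<^bsub>?Q\<^esub> x = \<zero>\<^bsub>?Q\<^esub>" if x: "x \<in> carrier ?Q" for x
    proof -
      obtain z where "z \<in> carrier M" "x = ?q z"
        using x carr by auto
      then show ?thesis
        by (intro bexI[of _ "?q (\<ominus>\<^bsub>M\<^esub> z)"]) (auto simp: carr q_add q_zero M.l_neg)
    qed
  qed (auto simp: carr q_add q_zero M.a_ac)
  then show "right_module R ?Q"
    by (intro right_module.intro right_module_axioms.intro R.ring_axioms)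
      (auto simp: carr q_add q_ract ract_add ract_add_scalar ract_assoc)
qed

text \<open>Submodules of M/N correspond to submodules of M above N. A finite generating set is
  lifted along the quotient map in one direction and pushed forward in the other.\<close>

lemma finitely_generated_quotient_iff:
  assumes N: "right_submodule R N M"
  shows "finitely_generated R (quotient_right_module M N) \<longleftrightarrow>
    (\<exists>S. finite S \<and> S \<subseteq> carrier M \<and>
      (\<forall>K. right_submodule R K M \<and> S \<subseteq> K \<and> N \<subseteq> K \<longrightarrow> carrier M \<subseteq> K))"
    (is "finitely_generated R ?Q \<longleftrightarrow> ?rhs")
proof -
  interpret Q: right_module R ?Q
    by (rule quotient_right_module_right_module[OF N])
  have add: "abelian_subgroup N M"
    using N by (simp add: right_submodule_def abelian_subgroupI3 M.abelian_group_axioms)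
  let ?q = "(+>\<^bsub>M\<^esub>) N"
  note hom = quotient_right_module_right_module(2)[OF N]
  have carr: "carrier ?Q = ?q ` carrier M"
    by (simp add: quotient_simps)
  have q_N: "?q x = \<zero>\<^bsub>?Q\<^esub>" if "x \<in> N" for x
    using abelian_subgroup.a_rcos_const[OF add that] by (simp add: quotient_simps)
  show ?thesis
  proof
    assume "finitely_generated R ?Q"
    then obtain S' where S': "finite S'" "S' \<subseteq> ?q ` carrier M" "right_span R ?Q S' = carrier ?Q"
      unfolding finitely_generated_def carr by blast
    then obtain S where S: "finite S" "S \<subseteq> carrier M" "S' = ?q ` S"
      by (meson finite_subset_image)
    have "\<forall>K. right_submodule R K M \<and> S \<subseteq> K \<and> N \<subseteq> K \<longrightarrow> carrier M \<subseteq> K"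
    proof (intro allI impI subsetI, elim conjE)
      fix K x assume K: "right_submodule R K M" "S \<subseteq> K" "N \<subseteq> K" and x: "x \<in> carrier M"
      \<comment> \<open>The image of K is a submodule containing the generators S', so it is
        everything. Each x is then congruent modulo N to some k in K, and N lies in K.\<close>
      have "carrier ?Q \<subseteq> ?q ` K"
        using right_module.right_span_minimal[OF Q.right_module_axioms
            right_submodule_image[OF Q.right_module_axioms hom K(1)], of S'] S(3) K(2) S'(3)
        by auto
      then obtain k where k: "k \<in> K" "?q x = ?q k"
        using x carr by blast
      then have "x \<in> N +>\<^bsub>M\<^esub> k"
        using abelian_subgroup.a_rcos_self[OF add x] by simp
      then show "x \<in> K"
        using k(1) K(3) right_submoduleD(3)[OF K(1)] by (auto simp: a_r_coset_def')
    qed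
    then show ?rhs using S by (intro exI[of _ S] conjI)
  next
    assume ?rhs
    then obtain S where S: "finite S" "S \<subseteq> carrier M"
      and gen: "\<forall>K. right_submodule R K M \<and> S \<subseteq> K \<and> N \<subseteq> K \<longrightarrow> carrier M \<subseteq> K"
      by (elim exE conjE) (rule that)
    let ?L = "right_span R ?Q (?q ` S)"
    have L: "right_submodule R ?L ?Q"
      using S(2) carr by (intro Q.right_span_submodule) auto
    \<comment> \<open>The hypothesis on S is applied to the preimage of the span of its
      image.\<close>
    have "carrier M \<subseteq> {x \<in> carrier M. ?q x \<in> ?L}"
    proof (rule gen[rule_format], intro conjI)
      show "right_submodule R {x \<in> carrier M. ?q x \<in> ?L} M"
        by (rule right_submodule_vimage[OF Q.right_module_axioms hom L])
      show "S \<subseteq> {x \<in> carrier M. ?q x \<in> ?L}"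
        using S(2) Q.right_span_incl[of "?q ` S"] by auto
      show "N \<subseteq> {x \<in> carrier M. ?q x \<in> ?L}"
        using q_N right_submoduleD(2)[OF L] right_submoduleD(1)[OF N] by auto
    qed
    then have "right_span R ?Q (?q ` S) = carrier ?Q"
      using carr right_submoduleD(1)[OF L] by auto
    then show "finitely_generated R ?Q"
      unfolding finitely_generated_def using S carr by (intro exI[of _ "?q ` S"]) auto
  qed
qed

text \<open>A submodule contains MI as soon as it contains every product x r with r in I. This
  translation removes the modules M/MI from the rest of the argument.\<close>

lemma fg_quotient_ideals_iff:
  "I \<in> fg_quotient_ideals R M \<longleftrightarrow>
     ideal I R \<and> (\<exists>S. finite S \<and> S \<subseteq> carrier M \<and> generates_modulo S I)"
proof (cases "ideal I R")
  case True
  let ?X = "{x \<triangleleft>\<^bsub>M\<^esub> r | x r. x \<in> carrier M \<and> r \<in> I}"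
  have X: "?X \<subseteq> carrier M"
    using ideal_subset_carrier[OF True] by auto
  have "module_times_ideal R M I \<subseteq> K \<longleftrightarrow> (\<forall>x\<in>carrier M. \<forall>r\<in>I. x \<triangleleft>\<^bsub>M\<^esub> r \<in> K)"
    if "right_submodule R K M" for K
    using right_span_minimal[OF that, of ?X] right_span_incl[of ?X]
    unfolding module_times_ideal_def by blast
  then have "generates_modulo S I \<longleftrightarrow>
      (\<forall>K. right_submodule R K M \<and> S \<subseteq> K \<and> module_times_ideal R M I \<subseteq> K \<longrightarrow> carrier M \<subseteq> K)" for S
    unfolding generates_modulo_def by meson
  moreover have "right_submodule R (module_times_ideal R M I) M"
    using right_span_submodule[OF X] unfolding module_times_ideal_def .
  ultimately show ?thesis
    using True finitely_generated_quotient_iff by (simp add: fg_quotient_ideals_def)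
qed (simp add: fg_quotient_ideals_def)

end

section \<open>The Jacobson radical\<close>

lemma regular_simps [simp]:
  "carrier (regular_right_module R) = carrier R"
  "\<zero>\<^bsub>regular_right_module R\<^esub> = \<zero>\<^bsub>R\<^esub>"
  "add (regular_right_module R) = add R"
  "ract (regular_right_module R) = monoid.mult R"
  by (simp_all add: regular_right_module_def)

context ring
begin

lemma regular_right_module: "right_module R (regular_right_module R)"
proof -
  have "abelian_group (regular_right_module R)"
    by (rule abelian_groupI) (auto simp: a_ac intro!: bexI[of _ "\<ominus> x" for x] l_neg)
  then show ?thesis
    by (intro right_module.intro right_module_axioms.intro ring_axioms)
      (auto simp: l_distr r_distr m_assoc)
qed

text \<open>A right ideal is proper exactly when it omits 1, and omitting 1 survives unions of
  chains, so Zorn's lemma applies to the right ideals above N that omit 1.\<close>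

lemma maximal_right_ideal_exists:
  assumes N: "right_submodule R N (regular_right_module R)" and "\<one> \<notin> N"
  shows "\<exists>K. maximal_right_submodule R K (regular_right_module R) \<and> N \<subseteq> K"
proof -
  let ?A = "{K. right_submodule R K (regular_right_module R) \<and> N \<subseteq> K \<and> \<one> \<notin> K}"
  have "\<exists>K\<in>?A. \<forall>X\<in>?A. K \<subseteq> X \<longrightarrow> X = K"
  proof (rule subset_Zorn_nonempty)
    show "?A \<noteq> {}"
      using assms by auto
    show "\<Union>C \<in> ?A" if C: "C \<noteq> {}" "subset.chain ?A C" for C
    proof -
      have sub: "right_submodule R K (regular_right_module R)" if "K \<in> C" for K
        using C that by (auto simp: subset_chain_def)
      have "right_submodule R (\<Union>C) (regular_right_module R)"
      proof (rule right_module.right_submoduleI[OF regular_right_module])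
        show "x \<oplus>\<^bsub>regular_right_module R\<^esub> y \<in> \<Union>C" if xy: "x \<in> \<Union>C" "y \<in> \<Union>C" for x y
        proof -
          obtain K where "K \<in> C" "x \<in> K" "y \<in> K"
            using xy C(2) unfolding subset_chain_def by blast
          then show ?thesis
            using right_submoduleD(3)[OF sub] by blast
        qed
        show "x \<triangleleft>\<^bsub>regular_right_module R\<^esub> r \<in> \<Union>C" if "x \<in> \<Union>C" "r \<in> carrier R" for x r
          using that right_submoduleD(4)[OF sub] by blast
      qed (use C(1) right_submoduleD(1,2)[OF sub] in auto)
      then show ?thesis
        using C by (auto simp: subset_chain_def)
    qed
  qed
  then obtain K where K: "K \<in> ?A" and max: "\<And>X. \<lbrakk>X \<in> ?A; K \<subseteq> X\<rbrakk> \<Longrightarrow> X = K"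
    by (elim bexE) (rule that, blast+)
  have "L = carrier R" if L: "right_submodule R L (regular_right_module R)" "\<one> \<in> L" for L
    using right_submoduleD(1)[OF L(1)] right_submoduleD(4)[OF L(1,2)] by force
  then have "L = K \<or> L = carrier R"
    if "right_submodule R L (regular_right_module R)" "K \<subseteq> L" for L
    using that max[of L] K by (cases "\<one> \<in> L") auto
  moreover have "K \<noteq> carrier R"
    using K by auto
  ultimately have "maximal_right_submodule R K (regular_right_module R)"
    using K unfolding maximal_right_submodule_def by simp
  then show ?thesis
    using K by blast
qed

lemma jacobson_radical_subset: "jacobson_radical R \<subseteq> carrier R"
  by (auto simp: jacobson_radical_def)

lemma jacobson_radicalD:
  "\<lbrakk>x \<in> jacobson_radical R; maximal_right_submodule R N (regular_right_module R)\<rbrakk> \<Longrightarrow> x \<in> N"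
  by (simp add: jacobson_radical_def)

text \<open>If (1 - j)R were proper, it would lie in a maximal right ideal. That ideal also contains
  j, hence contains 1 = (1 - j) + j.\<close>

lemma jacobson_radical_right_inverse:
  assumes j: "j \<in> jacobson_radical R"
  shows "\<exists>u\<in>carrier R. (\<one> \<ominus> j) \<otimes> u = \<one>"
proof (rule ccontr)
  interpret reg: right_module R "regular_right_module R"
    by (rule regular_right_module)
  have jc: "j \<in> carrier R"
    using j jacobson_radical_subset by auto
  let ?N = "(\<lambda>u. (\<one> \<ominus> j) \<otimes> u) ` carrier R"
  assume "\<not> ?thesis"
  then have "\<one> \<notin> ?N"
    by auto
  moreover have "right_submodule R ?N (regular_right_module R)"
  proof (rule reg.right_submoduleI)
    show "\<zero>\<^bsub>regular_right_module R\<^esub> \<in> ?N"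
      using jc by (auto intro!: image_eqI[of _ _ \<zero>])
  qed (use jc in \<open>auto simp: r_distr[symmetric] m_assoc\<close>)
  ultimately obtain K where K: "maximal_right_submodule R K (regular_right_module R)" "?N \<subseteq> K"
    using maximal_right_ideal_exists by blast
  then have Ksub: "right_submodule R K (regular_right_module R)"
    by (simp add: maximal_right_submodule_def)
  have "\<one> \<ominus> j \<in> ?N"
    using jc by (auto intro!: image_eqI[of _ _ \<one>])
  then have "(\<one> \<ominus> j) \<oplus> j \<in> K"
    using right_submoduleD(3)[OF Ksub, of "\<one> \<ominus> j" j] K jacobson_radicalD[OF j K(1)] by auto
  moreover have "(\<one> \<ominus> j) \<oplus> j = \<one>"
    using jc by (simp add: a_minus_def a_assoc l_neg)
  ultimately have "\<one> \<in> K" by simp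
  then have "K = carrier R"
    using right_submoduleD(1)[OF Ksub] right_submoduleD(4)[OF Ksub] by force
  then show False
    using K(1) by (simp add: maximal_right_submodule_def)
qed

text \<open>The right ideals \<open>(N : r)\<close> are the annihilators of the elements of the simple module \<open>R/N\<close>.\<close>

lemma maximal_right_ideal_quotient:
  assumes N: "maximal_right_submodule R N (regular_right_module R)"
    and r: "r \<in> carrier R" "r \<notin> N"
  shows "maximal_right_submodule R {y \<in> carrier R. r \<otimes> y \<in> N} (regular_right_module R)"
    (is "maximal_right_submodule R ?K _")
proof -
  interpret reg: right_module R "regular_right_module R"
    by (rule regular_right_module)
  have Nsub: "right_submodule R N (regular_right_module R)"
    and Nmax: "\<And>K. \<lbrakk>right_submodule R K (regular_right_module R); N \<subseteq> K\<rbrakk> \<Longrightarrow> K = N \<or> K = carrier R"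
    using N by (simp_all add: maximal_right_submodule_def)
  have Nc: "x \<in> carrier R" if "x \<in> N" for x
    using right_submoduleD(1)[OF Nsub] that by auto
  have sub: "right_submodule R ?K (regular_right_module R)"
  proof (rule reg.right_submoduleI)
  qed (use right_submoduleD[OF Nsub] r in \<open>auto simp: r_distr m_assoc[symmetric]\<close>)
  have "L = carrier R"
    if L: "right_submodule R L (regular_right_module R)" "?K \<subseteq> L" "L \<noteq> ?K" for L
  proof -
    obtain y where y: "y \<in> L" "y \<in> carrier R" "r \<otimes> y \<notin> N"
      using L right_submoduleD(1)[OF L(1)] by auto
    \<comment> \<open>N + ryR is strictly larger than N, hence equal to R. Writing r z = n + r y t
      puts z - y t into (N : r), which lies in L; since y is in L, so is z.\<close>
    let ?T = "{n \<oplus>\<^bsub>regular_right_module R\<^esub> (r \<otimes> y) \<otimes>\<^bsub>R\<^esub> t | n t. n \<in> N \<and> t \<in> carrier R}"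
    have T: "right_submodule R ?T (regular_right_module R)"
      using reg.right_submodule_add_ract_ideal[OF Nsub oneideal, of "r \<otimes> y"] r y by simp
    have "N \<subseteq> ?T"
      using Nc r y by (force intro: exI[of _ "\<zero>"])
    moreover have "r \<otimes> y \<in> ?T"
      using right_submoduleD(2)[OF Nsub] r y by (force intro: exI[of _ "\<one>"])
    ultimately have T_eq: "?T = carrier R"
      using Nmax[OF T] y by blast
    show "L = carrier R"
    proof
      show "L \<subseteq> carrier R"
        using right_submoduleD(1)[OF L(1)] by simp
      show "carrier R \<subseteq> L"
      proof
        fix z assume z: "z \<in> carrier R"
        then have "r \<otimes> z \<in> ?T"
          using T_eq r by auto
        then obtain n t where nt: "n \<in> N" "t \<in> carrier R" "r \<otimes> z = n \<oplus> r \<otimes> y \<otimes> t"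
          by auto
        then have "r \<otimes> (z \<ominus> y \<otimes> t) = n"
          using r y z Nc[OF nt(1)]
          by (simp add: a_minus_def r_distr r_minus m_assoc a_assoc r_neg)
        then have "z \<ominus> y \<otimes> t \<in> L"
          using L(2) nt y z by auto
        then have "(z \<ominus> y \<otimes> t) \<oplus> y \<otimes> t \<in> L"
          using right_submoduleD(3,4)[OF L(1)] y(1) nt(2) by fastforce
        then show "z \<in> L"
          using y z nt(2) by (simp add: a_minus_def a_assoc l_neg)
      qed
    qed
  qed
  moreover have "?K \<noteq> carrier R"
  proof
    assume "?K = carrier R"
    then have "r \<otimes> \<one> \<in> N" by blast
    then show False using r by simp
  qed
  ultimately show ?thesis
    using sub unfolding maximal_right_submodule_def by auto
qed

text \<open>As an intersection of right ideals the radical is a right ideal. For left multiplication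
  by x, let N be a maximal right ideal not containing x: then (N : x) is again maximal, so it
  contains a, that is, x a is in N.\<close>

lemma jacobson_radical_ideal: "ideal (jacobson_radical R) R"
proof (rule idealI)
  let ?J = "jacobson_radical R"
  interpret reg: right_module R "regular_right_module R"
    by (rule regular_right_module)
  have maxD: "right_submodule R N (regular_right_module R)"
    if "maximal_right_submodule R N (regular_right_module R)" for N
    using that by (simp add: maximal_right_submodule_def)
  have sub: "right_submodule R ?J (regular_right_module R)"
  proof (rule reg.right_submoduleI)
  qed (use right_submoduleD[OF maxD] in \<open>auto simp: jacobson_radical_def\<close>)
  show "subgroup ?J (add_monoid R)"
  proof (rule add.subgroupI)
    show "\<ominus> a \<in> ?J" if "a \<in> ?J" for a
      using right_submoduleD(4)[OF sub that, of "\<ominus> \<one>"] that jacobson_radical_subset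
      by (auto simp: r_minus)
  qed (use right_submoduleD[OF sub] in auto)
  show "a \<otimes> x \<in> ?J" if "a \<in> ?J" "x \<in> carrier R" for a x
    using right_submoduleD(4)[OF sub that(1)] that(2) by simp
  show "x \<otimes> a \<in> ?J" if a: "a \<in> ?J" and x: "x \<in> carrier R" for a x
  proof -
    have "x \<otimes> a \<in> N" if N: "maximal_right_submodule R N (regular_right_module R)" for N
    proof (cases "x \<in> N")
      case True
      then show ?thesis
        using right_submoduleD(4)[OF maxD[OF N], of x a] a jacobson_radical_subset by auto
    next
      case False
      then show ?thesis
        using jacobson_radicalD[OF a maximal_right_ideal_quotient[OF N x]] by auto
    qed
    then show ?thesis
      using a x jacobson_radical_subset by (auto simp: jacobson_radical_def)
  qed
qed (rule ring_axioms)

text \<open>A family without such an I yields a descending sequence in which no term lies in its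
  successor plus J(R). The images in R/J(R) form a descending chain of right ideals, which becomes
  stationary by the artinian condition, a contradiction.\<close>

lemma semilocal_minimal_ideal_modulo_radical:
  assumes "semilocal R" and sub: "\<I> \<subseteq> {I. ideal I R}" and ne: "\<I> \<noteq> {}"
  shows "\<exists>I\<in>\<I>. \<forall>K\<in>\<I>. K \<subseteq> I \<longrightarrow> I \<subseteq> K <+> jacobson_radical R"
proof (rule ccontr)
  let ?J = "jacobson_radical R"
  let ?Q = "R Quot ?J"
  let ?q = "(+>) ?J"
  interpret J: ideal ?J R
    by (rule jacobson_radical_ideal)
  interpret Q: ring ?Q
    by (rule J.quotient_is_ring)
  interpret reg: right_module ?Q "regular_right_module ?Q"
    by (rule Q.regular_right_module)
  note hom = J.rcos_ring_hom
  have carr: "carrier ?Q = ?q ` carrier R"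
    by (auto simp: FactRing_def A_RCOSETS_def')
  \<comment> \<open>Every scalar of the quotient ring is the class of an element of R, so right
    absorption passes to the image.\<close>
  have image: "right_submodule ?Q (?q ` I) (regular_right_module ?Q)" if I: "ideal I R" for I
  proof (rule reg.right_submoduleI)
    note Ic = ideal_subset_carrier[OF I, THEN subsetD]
    interpret I: ideal I R by fact
    show "?q ` I \<subseteq> carrier (regular_right_module ?Q)"
      using Ic by (auto simp: carr)
    show "\<zero>\<^bsub>regular_right_module ?Q\<^esub> \<in> ?q ` I"
      using ring_hom_zero[OF hom ring_axioms Q.ring_axioms] I.zero_closed by force
    show "x \<oplus>\<^bsub>regular_right_module ?Q\<^esub> y \<in> ?q ` I" if "x \<in> ?q ` I" "y \<in> ?q ` I" for x y
      using that Ic I.a_closed by (auto simp: ring_hom_add[OF hom, symmetric])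
    show "x \<triangleleft>\<^bsub>regular_right_module ?Q\<^esub> r \<in> ?q ` I"
      if "x \<in> ?q ` I" "r \<in> carrier ?Q" for x r
      using that Ic I.I_r_closed by (auto simp: carr ring_hom_mult[OF hom, symmetric])
  qed
  assume "\<not> ?thesis"
  then have "\<forall>I\<in>\<I>. \<exists>K\<in>\<I>. K \<subseteq> I \<and> \<not> I \<subseteq> K <+> ?J"
    by blast
  then obtain c where c: "\<And>I. I \<in> \<I> \<Longrightarrow> c I \<in> \<I> \<and> c I \<subseteq> I \<and> \<not> I \<subseteq> c I <+> ?J"
    by metis
  obtain I0 where I0: "I0 \<in> \<I>"
    using ne by blast
  \<comment> \<open>The offending sequence arises by iterating the choice function \<open>c\<close>,
    which sends an ideal of the family to a smaller one violating the inclusion.\<close>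
  define I where "I = (\<lambda>n::nat. (c ^^ n) I0)"
  have I_in: "I n \<in> \<I>" for n
    by (induction n) (use I0 c in \<open>auto simp: I_def\<close>)
  then have ideals: "ideal (I n) R" for n
    using sub by blast
  have I_Suc: "I (Suc n) \<subseteq> I n" "\<not> I n \<subseteq> I (Suc n) <+> ?J" for n
    using c[OF I_in[of n]] by (auto simp: I_def)
  have "artinian_right_module ?Q (regular_right_module ?Q)"
    using assms(1) by (simp add: semilocal_def semisimple_artinian_def)
  then obtain n where n: "\<And>m. m \<ge> n \<Longrightarrow> ?q ` I m = ?q ` I n"
    unfolding artinian_right_module_def
    using image[OF ideals] I_Suc(1) by (meson image_mono)
  have "I n \<subseteq> I (Suc n) <+> ?J"
  proof
    fix x assume x: "x \<in> I n"
    note Ic = ideal_subset_carrier[OF ideals, THEN subsetD]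
    \<comment> \<open>Equal images at n and n + 1 let x be replaced by some y in the next ideal with
      x - y in the radical.\<close>
    have "?q x \<in> ?q ` I (Suc n)"
      using n[of "Suc n"] x by simp
    then obtain y where y: "y \<in> I (Suc n)" "?q x = ?q y"
      by (elim imageE)
    then have "x \<in> ?J +> y"
      using J.a_rcos_self[OF Ic[OF x]] by simp
    then obtain j where "j \<in> ?J" "x = j \<oplus> y"
      by (auto simp: a_r_coset_def')
    then show "x \<in> I (Suc n) <+> ?J"
      using y(1) Ic[OF y(1)] a_comm J.a_subset by (force simp: set_add_def')
  qed
  then show False
    using I_Suc(2) by blast
qed

end

text \<open>The hypotheses say M = N + SR with S finite and M = N + MJ, where J is the radical.
  Induction on S with N arbitrary: adding one generator s to N gives M = N + sR, so MJ lies in N +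
  sJ and M = N + sJ. Then s = n + s j, so s (1 - j) = n lies in N, and a right inverse of 1 - j
  brings s into N.\<close>

lemma (in right_module) nakayama:
  assumes "finite S" "S \<subseteq> carrier M" "right_submodule R N M"
    and "generates_modulo (N \<union> S) {}"
    and "generates_modulo N (jacobson_radical R)"
  shows "carrier M \<subseteq> N"
  using assms
proof (induction S arbitrary: N rule: finite_induct)
  case empty
  then show ?case
    using generates_moduloD[of N "{}" N] by simp
next
  case (insert s S)
  let ?J = "jacobson_radical R"
  note N = insert.prems(2)
  have J: "ideal ?J R"
    by (rule R.jacobson_radical_ideal)
  have s: "s \<in> carrier M"
    using insert.prems(1) by simp
  note Nc = right_submoduleD(1)[OF N, THEN subsetD]
    and Jc = R.jacobson_radical_subset[THEN subsetD]
  let ?L = "\<lambda>I. {n \<oplus>\<^bsub>M\<^esub> s \<triangleleft>\<^bsub>M\<^esub> t | n t. n \<in> N \<and> t \<in> I}"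
  have N_sub: "N \<subseteq> ?L I" if "\<zero> \<in> I" for I
    using Nc s that by (force intro: exI[of _ "\<zero>"])
  have "s \<in> ?L (carrier R)"
    using right_submoduleD(2)[OF N] s by (force intro: exI[of _ "\<one>"])
  then have "generates_modulo (?L (carrier R) \<union> S) {}"
    using N_sub[of "carrier R"] by (intro generates_modulo_mono[OF insert.prems(3)]) blast+
  moreover have "generates_modulo (?L (carrier R)) ?J"
    using N_sub[of "carrier R"] by (intro generates_modulo_mono[OF insert.prems(4)]) blast+
  \<comment> \<open>The induction hypothesis is used for N + sR in place of N, with one generator
    fewer.\<close>
  ultimately have "carrier M \<subseteq> ?L (carrier R)"
    using insert.prems(1)
    by (intro insert.IH right_submodule_add_ract_ideal N R.oneideal s) blast+
  have "carrier M \<subseteq> ?L ?J"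
  proof (rule generates_moduloD[OF insert.prems(4)])
    show "right_submodule R (?L ?J) M"
      by (rule right_submodule_add_ract_ideal[OF N J s])
    show "N \<subseteq> ?L ?J"
      using N_sub additive_subgroup.zero_closed[OF ideal.axioms(1)[OF J]] by blast
    show "x \<triangleleft>\<^bsub>M\<^esub> r \<in> ?L ?J" if x: "x \<in> carrier M" and r: "r \<in> ?J" for x r
    proof -
      obtain n t where nt: "n \<in> N" "t \<in> carrier R" "x = n \<oplus>\<^bsub>M\<^esub> s \<triangleleft>\<^bsub>M\<^esub> t"
        using x \<open>carrier M \<subseteq> ?L (carrier R)\<close> by blast
      then have "x \<triangleleft>\<^bsub>M\<^esub> r = n \<triangleleft>\<^bsub>M\<^esub> r \<oplus>\<^bsub>M\<^esub> s \<triangleleft>\<^bsub>M\<^esub> (t \<otimes> r)"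
        using s Nc Jc[OF r] by (simp add: ract_add ract_assoc)
      moreover have "n \<triangleleft>\<^bsub>M\<^esub> r \<in> N" "t \<otimes> r \<in> ?J"
        using right_submoduleD(4)[OF N] nt Jc[OF r] ideal.I_l_closed[OF J] r by auto
      ultimately show ?thesis by blast
    qed
  qed
  then obtain n j where nj: "n \<in> N" "j \<in> ?J" "s = n \<oplus>\<^bsub>M\<^esub> s \<triangleleft>\<^bsub>M\<^esub> j"
    using s by blast
  \<comment> \<open>Only a right inverse is called for: s = s ((1 - j) u) = n u.\<close>
  obtain u where u: "u \<in> carrier R" "(\<one> \<ominus> j) \<otimes> u = \<one>"
    using R.jacobson_radical_right_inverse[OF nj(2)] by blast
  have "s \<triangleleft>\<^bsub>M\<^esub> (\<one> \<ominus> j) = s \<oplus>\<^bsub>M\<^esub> \<ominus>\<^bsub>M\<^esub> (s \<triangleleft>\<^bsub>M\<^esub> j)"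
    using s Jc[OF nj(2)] by (simp add: a_minus_def ract_add_scalar ract_minus)
  also have "\<dots> = (n \<oplus>\<^bsub>M\<^esub> s \<triangleleft>\<^bsub>M\<^esub> j) \<oplus>\<^bsub>M\<^esub> \<ominus>\<^bsub>M\<^esub> (s \<triangleleft>\<^bsub>M\<^esub> j)"
    using nj(3) by simp
  also have "\<dots> = n"
    using s Nc[OF nj(1)] Jc[OF nj(2)] by (simp add: M.a_assoc M.r_neg)
  finally have "s = n \<triangleleft>\<^bsub>M\<^esub> u"
    using u s Jc[OF nj(2)] ract_assoc[of s "\<one> \<ominus> j" u] by simp
  then have "s \<in> N"
    using right_submoduleD(4)[OF N nj(1) u(1)] by simp
  then have "?L (carrier R) \<subseteq> N"
    using right_submoduleD(3,4)[OF N] by blast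
  then show ?case
    using \<open>carrier M \<subseteq> ?L (carrier R)\<close> by blast
qed

section \<open>Coordinates of projective modules\<close>

lemma free_simps:
  "f \<in> carrier (free_right_module R S) \<longleftrightarrow>
    (\<forall>x\<in>S. f x \<in> carrier R) \<and> (\<forall>x. x \<notin> S \<longrightarrow> f x = \<zero>\<^bsub>R\<^esub>) \<and> finite {x. f x \<noteq> \<zero>\<^bsub>R\<^esub>}"
  "\<zero>\<^bsub>free_right_module R S\<^esub> = (\<lambda>x. \<zero>\<^bsub>R\<^esub>)"
  "add (free_right_module R S) f g = (\<lambda>x. f x \<oplus>\<^bsub>R\<^esub> g x)"
  "ract (free_right_module R S) f r = (\<lambda>x. f x \<otimes>\<^bsub>R\<^esub> r)"
  by (simp_all add: free_right_module_def)

context ring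
begin

lemma free_carrierD:
  "f \<in> carrier (free_right_module R S) \<Longrightarrow> f x \<in> carrier R"
  by (cases "x \<in> S") (auto simp: free_simps)

lemma free_right_module:
  fixes S :: "'x set"
  shows "right_module R (free_right_module R S)" (is "right_module R ?F")
proof -
  \<comment> \<open>Finite supports are preserved because the support of the result lies in the
    union of the given supports.\<close>
  have fin: "finite {x. h x \<noteq> \<zero>}"
    if "finite {x. f x \<noteq> \<zero>}" "finite {x. g x \<noteq> \<zero>}" "\<And>x. f x = \<zero> \<Longrightarrow> g x = \<zero> \<Longrightarrow> h x = \<zero>"
    for f g h :: "'x \<Rightarrow> 'a"
    by (rule finite_subset[OF _ finite_UnI[OF that(1,2)]]) (use that(3) in auto)
  have "abelian_group ?F"
  proof (rule abelian_groupI)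
    show "f \<oplus>\<^bsub>?F\<^esub> g \<in> carrier ?F" if "f \<in> carrier ?F" "g \<in> carrier ?F" for f g
      using that by (auto simp: free_simps intro: fin[of f g])
    show "\<exists>g\<in>carrier ?F. g \<oplus>\<^bsub>?F\<^esub> f = \<zero>\<^bsub>?F\<^esub>" if f: "f \<in> carrier ?F" for f
    proof
      show "(\<lambda>x. \<ominus> f x) \<in> carrier ?F"
        using f by (auto simp: free_simps intro: fin[of f f])
      show "(\<lambda>x. \<ominus> f x) \<oplus>\<^bsub>?F\<^esub> f = \<zero>\<^bsub>?F\<^esub>"
        using free_carrierD[OF f] by (auto simp: free_simps l_neg)
    qed
  qed (auto simp: free_simps(2-) free_carrierD a_ac, simp add: free_simps)
  moreover have "f \<triangleleft>\<^bsub>?F\<^esub> r \<in> carrier ?F" if "f \<in> carrier ?F" "r \<in> carrier R" for f r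
    using that by (auto simp: free_simps intro: fin[of f f])
  ultimately show ?thesis
    by (intro right_module.intro right_module_axioms.intro ring_axioms)
      (auto simp: free_simps(2-) free_carrierD l_distr r_distr m_assoc)
qed

text \<open>An element of the free module is the finite sum of its one-coordinate pieces.
  Restricting f to finite sets A and inducting on A replaces a formal sum; the support of f is the A
  that matters.\<close>

lemma free_right_module_memI:
  assumes N: "right_submodule R N (free_right_module R S)"
    and f: "f \<in> carrier (free_right_module R S)"
    and single: "\<And>s. f s \<noteq> \<zero> \<Longrightarrow> (\<lambda>x. if x = s then f s else \<zero>) \<in> N"
  shows "f \<in> N"
proof -
  have "(\<lambda>x. if x \<in> A then f x else \<zero>) \<in> N" if "finite A" for A
    using that
  proof induction
    case empty
    then show ?case
      using right_submoduleD(2)[OF N] by (simp add: free_simps)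
  next
    case (insert s A)
    \<comment> \<open>When f s = 0 the piece is the zero function, which \<open>single\<close> does
      not cover.\<close>
    have "(\<lambda>x. if x = s then f s else \<zero>) \<in> N"
      using single[of s] right_submoduleD(2)[OF N] by (cases "f s = \<zero>") (simp_all add: free_simps cong: if_cong)
    from right_submoduleD(3)[OF N this insert.IH]
    have "(\<lambda>x. (if x = s then f s else \<zero>) \<oplus> (if x \<in> A then f x else \<zero>)) \<in> N"
      by (simp add: free_simps)
    moreover have "(if x = s then f s else \<zero>) \<oplus> (if x \<in> A then f x else \<zero>)
        = (if x \<in> insert s A then f x else \<zero>)" for x
      using insert.hyps free_carrierD[OF f] by auto
    ultimately show ?case by simp
  qed
  from this[of "{x. f x \<noteq> \<zero>}"]
  have "(\<lambda>x. if f x \<noteq> \<zero> then f x else \<zero>) \<in> N"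
    using f by (simp add: free_simps)
  moreover have "(\<lambda>x. if f x \<noteq> \<zero> then f x else \<zero>) = f"
    by auto
  ultimately show ?thesis by simp
qed

end

context right_module
begin

text \<open>
  The dual basis lemma: the identity \<open>x = \<Sum>s. p s \<triangleleft> g s x\<close> enters only through the last property.
\<close>

lemma projective_dual_basis:
  assumes "projective_right_module R M"
  obtains p :: "'b \<Rightarrow> 'b" and g :: "'b \<Rightarrow> 'b \<Rightarrow> 'a"
  where "\<And>s. g s \<in> right_module_hom R M (regular_right_module R)"
    and "\<And>x. x \<in> carrier M \<Longrightarrow> finite {s. g s x \<noteq> \<zero>}"
    and "\<And>s. p s \<in> carrier M"
    and "\<And>N x. \<lbrakk>right_submodule R N M; x \<in> carrier M; \<And>s. p s \<triangleleft>\<^bsub>M\<^esub> g s x \<in> N\<rbrakk> \<Longrightarrow> x \<in> N"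
proof -
  from assms obtain S A B f where
    A: "right_submodule R A (free_right_module R (S :: 'b set))"
    and B: "right_submodule R B (free_right_module R S)"
    and AB: "A \<inter> B = {\<zero>\<^bsub>free_right_module R S\<^esub>}"
      "A <+>\<^bsub>free_right_module R S\<^esub> B = carrier (free_right_module R S)"
    and f: "f \<in> right_module_hom R M (free_right_module R S)"
    and bij: "bij_betw f (carrier M) A"
    unfolding projective_right_module_def Let_def by (elim exE conjE) (rule that)
  let ?F = "free_right_module R S"
  interpret F: right_module R ?F
    by (rule R.free_right_module)
  have fc: "f x \<in> carrier ?F" if "x \<in> carrier M" for x
    using f that by (auto simp: right_module_hom_def)
  have f_ract: "f (x \<triangleleft>\<^bsub>M\<^esub> r) = f x \<triangleleft>\<^bsub>?F\<^esub> r" if "x \<in> carrier M" "r \<in> carrier R" for x r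
    using f that by (auto simp: right_module_hom_def)
  let ?e = "\<lambda>s x. if x = s then \<one> else \<zero>"
  \<comment> \<open>The dual basis elements are the components in A of the standard basis vectors,
    pulled back along f.\<close>
  have "\<exists>p\<in>carrier M. \<exists>b\<in>B. ?e s = f p \<oplus>\<^bsub>?F\<^esub> b" if s: "s \<in> S" for s
  proof -
    have "?e s \<in> carrier ?F"
      using s by (auto simp: free_simps)
    then obtain a b where "a \<in> A" "b \<in> B" "?e s = a \<oplus>\<^bsub>?F\<^esub> b"
      unfolding AB(2)[symmetric] by (auto simp: set_add_def')
    moreover obtain p where "p \<in> carrier M" "a = f p"
      using bij \<open>a \<in> A\<close> by (auto simp: bij_betw_def)
    ultimately show ?thesis by blast
  qed
  then obtain p0 where p0: "\<And>s. s \<in> S \<Longrightarrow> p0 s \<in> carrier M \<and> (\<exists>b\<in>B. ?e s = f (p0 s) \<oplus>\<^bsub>?F\<^esub> b)"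
    by metis
  \<comment> \<open>The value zero outside S makes \<open>p\<close> total with values in M; the
    coordinates f x s vanish there.\<close>
  define p where "p = (\<lambda>s. if s \<in> S then p0 s else \<zero>\<^bsub>M\<^esub>)"
  have pc: "p s \<in> carrier M" for s
    using p0 by (simp add: p_def)
  show thesis
  proof (rule that[of "\<lambda>s x. f x s" p])
    show "(\<lambda>x. f x s) \<in> right_module_hom R M (regular_right_module R)" for s
      using f R.free_carrierD[OF fc] by (auto simp: right_module_hom_def free_simps(2-))
    show "finite {s. f x s \<noteq> \<zero>}" if "x \<in> carrier M" for x
      using fc[OF that] by (simp add: free_simps)
    show "p s \<in> carrier M" for s
      by (rule pc)
    fix N x assume N: "right_submodule R N M" and x: "x \<in> carrier M"
      and px: "\<And>s. p s \<triangleleft>\<^bsub>M\<^esub> f x s \<in> N"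
    have fN: "right_submodule R (f ` N) ?F"
      by (rule right_submodule_image[OF F.right_module_axioms f N])
    \<comment> \<open>The sum f(N) + B serves to test membership coordinate by coordinate. Modulo B
      the basis vector at s equals f (p s), so the piece of f x at s is f (p s t) plus an element of
      B, where t = f x s.\<close>
    define \<Phi> where "\<Phi> = {n \<oplus>\<^bsub>?F\<^esub> b | n b. n \<in> f ` N \<and> b \<in> B}"
    note fNc = right_submoduleD(1)[OF fN, THEN subsetD]
      and Bc = right_submoduleD(1)[OF B, THEN subsetD]
    have \<Phi>: "right_submodule R \<Phi> ?F"
    proof (rule F.right_submoduleI)
      show "\<Phi> \<subseteq> carrier ?F"
        using fNc Bc by (auto simp: \<Phi>_def)
      have "\<zero>\<^bsub>?F\<^esub> = \<zero>\<^bsub>?F\<^esub> \<oplus>\<^bsub>?F\<^esub> \<zero>\<^bsub>?F\<^esub>"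
        by simp
      then show "\<zero>\<^bsub>?F\<^esub> \<in> \<Phi>"
        using right_submoduleD(2)[OF fN] right_submoduleD(2)[OF B] unfolding \<Phi>_def by blast
      show "y \<oplus>\<^bsub>?F\<^esub> z \<in> \<Phi>" if yz: "y \<in> \<Phi>" "z \<in> \<Phi>" for y z
      proof -
        obtain n b n' b' where *: "n \<in> f ` N" "b \<in> B" "y = n \<oplus>\<^bsub>?F\<^esub> b"
          "n' \<in> f ` N" "b' \<in> B" "z = n' \<oplus>\<^bsub>?F\<^esub> b'"
          using yz unfolding \<Phi>_def by blast
        then have "y \<oplus>\<^bsub>?F\<^esub> z = (n \<oplus>\<^bsub>?F\<^esub> n') \<oplus>\<^bsub>?F\<^esub> (b \<oplus>\<^bsub>?F\<^esub> b')"
          using fNc Bc by (simp add: F.M.a_ac)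
        then show ?thesis
          using * right_submoduleD(3)[OF fN] right_submoduleD(3)[OF B] unfolding \<Phi>_def by blast
      qed
      show "y \<triangleleft>\<^bsub>?F\<^esub> r \<in> \<Phi>" if y: "y \<in> \<Phi>" and r: "r \<in> carrier R" for y r
      proof -
        obtain n b where *: "n \<in> f ` N" "b \<in> B" "y = n \<oplus>\<^bsub>?F\<^esub> b"
          using y unfolding \<Phi>_def by blast
        then have "y \<triangleleft>\<^bsub>?F\<^esub> r = n \<triangleleft>\<^bsub>?F\<^esub> r \<oplus>\<^bsub>?F\<^esub> b \<triangleleft>\<^bsub>?F\<^esub> r"
          using fNc Bc r by (simp add: F.ract_add)
        then show ?thesis
          using * r right_submoduleD(4)[OF fN] right_submoduleD(4)[OF B] unfolding \<Phi>_def by blast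
      qed
    qed
    have "f x \<in> \<Phi>"
    proof (rule R.free_right_module_memI[OF \<Phi> fc[OF x]])
      fix s assume "f x s \<noteq> \<zero>"
      then have s: "s \<in> S"
        using fc[OF x] by (auto simp: free_simps)
      let ?t = "f x s"
      have t: "?t \<in> carrier R"
        by (rule R.free_carrierD[OF fc[OF x]])
      obtain b where b: "b \<in> B" "?e s = f (p s) \<oplus>\<^bsub>?F\<^esub> b"
        using p0[OF s] s by (auto simp: p_def)
      have "(\<lambda>y. if y = s then ?t else \<zero>) = ?e s \<triangleleft>\<^bsub>?F\<^esub> ?t"
        using t by (auto simp: free_simps)
      also have "\<dots> = f (p s) \<triangleleft>\<^bsub>?F\<^esub> ?t \<oplus>\<^bsub>?F\<^esub> b \<triangleleft>\<^bsub>?F\<^esub> ?t"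
        unfolding b(2) by (rule F.ract_add[OF fc[OF pc] Bc[OF b(1)] t])
      also have "\<dots> = f (p s \<triangleleft>\<^bsub>M\<^esub> ?t) \<oplus>\<^bsub>?F\<^esub> b \<triangleleft>\<^bsub>?F\<^esub> ?t"
        by (simp only: f_ract[OF pc t])
      also have "\<dots> \<in> \<Phi>"
        using px[of s] right_submoduleD(4)[OF B b(1) t] unfolding \<Phi>_def by blast
      finally show "(\<lambda>y. if y = s then ?t else \<zero>) \<in> \<Phi>" .
    qed
    then obtain n b where nb: "n \<in> N" "b \<in> B" "f x = f n \<oplus>\<^bsub>?F\<^esub> b"
      unfolding \<Phi>_def by blast
    have n: "n \<in> carrier M"
      using right_submoduleD(1)[OF N] nb(1) by auto
    \<comment> \<open>The difference lies in A and in B, hence is zero; injectivity of f then gives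
      x = n.\<close>
    have "f x \<ominus>\<^bsub>?F\<^esub> f n = b"
      unfolding nb(3) using fc[OF n] Bc[OF nb(2)]
      by (simp add: a_minus_def F.M.a_comm[of "f n" b] F.M.a_assoc F.M.r_neg)
    moreover have "f x \<in> A" "f n \<in> A"
      using bij x n by (auto simp: bij_betw_def)
    ultimately have "b \<in> A \<inter> B"
      using F.right_submodule_minus[OF A] nb(2) by auto
    then have "f x = f n"
      using AB(1) nb(3) fc[OF n] by simp
    then show "x \<in> N"
      using bij x n nb(1) by (auto simp: bij_betw_def dest: inj_onD)
  qed
qed

section \<open>Generators common to all ideals, and the least ideal\<close>

lemma uniform_generators_modulo:
  assumes "semilocal R"
  shows "\<exists>S. finite S \<and> S \<subseteq> carrier M \<and> (\<forall>I\<in>fg_quotient_ideals R M. generates_modulo S I)"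
proof -
  have id: "ideal I R" if "I \<in> fg_quotient_ideals R M" for I
    using that fg_quotient_ideals_iff by blast
  \<comment> \<open>The whole ring belongs to the family, which is therefore nonempty.\<close>
  have "generates_modulo {} (carrier R)"
    unfolding generates_modulo_def
  proof (intro allI impI subsetI, elim conjE)
    fix N x assume "x \<in> carrier M" "\<forall>x\<in>carrier M. \<forall>r\<in>carrier R. x \<triangleleft>\<^bsub>M\<^esub> r \<in> N"
    then have "x \<triangleleft>\<^bsub>M\<^esub> \<one> \<in> N" by blast
    then show "x \<in> N" using \<open>x \<in> carrier M\<close> by simp
  qed
  then have "carrier R \<in> fg_quotient_ideals R M"
    using R.oneideal fg_quotient_ideals_iff by blast
  then have "fg_quotient_ideals R M \<noteq> {}" "fg_quotient_ideals R M \<subseteq> {I. ideal I R}"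
    using id by blast+
  from R.semilocal_minimal_ideal_modulo_radical[OF assms this(2,1)]
  obtain I where I: "I \<in> fg_quotient_ideals R M"
    and min: "\<forall>K\<in>fg_quotient_ideals R M. K \<subseteq> I \<longrightarrow> I \<subseteq> K <+>\<^bsub>R\<^esub> jacobson_radical R"
    by (elim bexE) (rule that)
  from I obtain S where S: "finite S" "S \<subseteq> carrier M" "generates_modulo S I"
    unfolding fg_quotient_ideals_iff by blast
  have "generates_modulo S K" if K: "K \<in> fg_quotient_ideals R M" for K
  proof -
    obtain T where T: "finite T" "T \<subseteq> carrier M" "generates_modulo T K"
      using K unfolding fg_quotient_ideals_iff by blast
    \<comment> \<open>Passing to the intersection puts the ideal below I, where the choice of I
      applies; generation modulo H implies generation modulo the larger K.\<close>
    let ?H = "I \<inter> K"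
    have gen: "generates_modulo (S \<union> T) ?H"
      by (rule generates_modulo_Int[OF id[OF I] id[OF K] S(3) T(3,2)])
    have H: "?H \<in> fg_quotient_ideals R M"
      unfolding fg_quotient_ideals_iff using S T gen R.i_intersect[OF id[OF I] id[OF K]]
      by (intro conjI exI[of _ "S \<union> T"]) auto
    have I_sub: "I \<subseteq> ?H <+>\<^bsub>R\<^esub> jacobson_radical R"
      using min[rule_format, OF H] by blast
    have "generates_modulo S ?H"
      unfolding generates_modulo_def
    proof (intro allI impI, elim conjE)
      fix N assume N: "right_submodule R N M" "S \<subseteq> N"
        and NH: "\<forall>x\<in>carrier M. \<forall>r\<in>?H. x \<triangleleft>\<^bsub>M\<^esub> r \<in> N"
      show "carrier M \<subseteq> N"
      \<comment> \<open>Here N contains S and MH. The extra set T provides finite generation over N,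
        and is then eliminated: I lies in H + J(R), so M = SR + MI is contained in N +
        MJ(R).\<close>
      proof (rule nakayama[OF _ _ N(1)])
        show "finite (S \<union> T)" "S \<union> T \<subseteq> carrier M"
          using S T by auto
        show "generates_modulo (N \<union> (S \<union> T)) {}"
          using gen NH unfolding generates_modulo_def by blast
        show "generates_modulo N (jacobson_radical R)"
          unfolding generates_modulo_def
        proof (intro allI impI, elim conjE)
          fix L assume L: "right_submodule R L M" "N \<subseteq> L"
            and LJ: "\<forall>x\<in>carrier M. \<forall>r\<in>jacobson_radical R. x \<triangleleft>\<^bsub>M\<^esub> r \<in> L"
          show "carrier M \<subseteq> L"
          proof (rule generates_moduloD[OF S(3) L(1)])
            show "S \<subseteq> L"
              using N(2) L(2) by blast
            show "x \<triangleleft>\<^bsub>M\<^esub> r \<in> L" if x: "x \<in> carrier M" and r: "r \<in> I" for x r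
            proof -
              obtain h j where hj: "h \<in> ?H" "j \<in> jacobson_radical R" "r = h \<oplus> j"
                using r I_sub by (auto simp: set_add_def')
              then have "x \<triangleleft>\<^bsub>M\<^esub> r = x \<triangleleft>\<^bsub>M\<^esub> h \<oplus>\<^bsub>M\<^esub> x \<triangleleft>\<^bsub>M\<^esub> j"
                using x ideal_subset_carrier[OF id[OF H]] R.jacobson_radical_subset
                by (auto intro!: ract_add_scalar)
              moreover have "x \<triangleleft>\<^bsub>M\<^esub> h \<in> L" "x \<triangleleft>\<^bsub>M\<^esub> j \<in> L"
                using NH L(2) LJ x hj by blast+
              ultimately show ?thesis
                using right_submoduleD(3)[OF L(1)] by simp
            qed
          qed
        qed
      qed
    qed
    then show ?thesis
      by (rule generates_modulo_mono) auto
  qed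
  then show ?thesis
    using S by blast
qed

lemma projective_least_fg_quotient_ideal:
  assumes "projective_right_module R M"
    and S: "finite S" "S \<subseteq> carrier M" "\<And>I. I \<in> fg_quotient_ideals R M \<Longrightarrow> generates_modulo S I"
  shows "\<exists>T\<in>fg_quotient_ideals R M. \<forall>I\<in>fg_quotient_ideals R M. T \<subseteq> I"
proof -
  obtain p :: "'b \<Rightarrow> 'b" and g :: "'b \<Rightarrow> 'b \<Rightarrow> 'a"
    where g: "\<And>s. g s \<in> right_module_hom R M (regular_right_module R)"
    and fin: "\<And>x. x \<in> carrier M \<Longrightarrow> finite {s. g s x \<noteq> \<zero>}"
    and p: "\<And>s. p s \<in> carrier M"
    and mem: "\<And>N x. \<lbrakk>right_submodule R N M; x \<in> carrier M; \<And>s. p s \<triangleleft>\<^bsub>M\<^esub> g s x \<in> N\<rbrakk> \<Longrightarrow> x \<in> N"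
    using projective_dual_basis[OF assms(1)] by metis
  have gc: "g s x \<in> carrier R" if "x \<in> carrier M" for s x
    using g[of s] that by (auto simp: right_module_hom_def)
  \<comment> \<open>These are the coordinates not vanishing identically on S. The set is finite
    because S is finite and each x has finitely many nonzero coordinates.\<close>
  define S0 where "S0 = (\<Union>x\<in>S. {s. g s x \<noteq> \<zero>})"
  have S0: "finite S0"
    using S(1,2) fin by (auto simp: S0_def)
  let ?X = "{g s x | s x. s \<notin> S0 \<and> x \<in> carrier M}"
  let ?T = "genideal R ?X"
  have X: "?X \<subseteq> carrier R"
    using gc by auto
  have "ideal ?T R"
    by (rule R.genideal_ideal[OF X])
  \<comment> \<open>Modulo MT the terms p s (g s x) with s outside \<open>S0\<close> disappear, so
    the finitely many p s with s in \<open>S0\<close> generate.\<close>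
  moreover have "generates_modulo (p ` S0) ?T"
    unfolding generates_modulo_def
  proof (intro allI impI subsetI, elim conjE)
    fix N x assume N: "right_submodule R N M" "p ` S0 \<subseteq> N" and x: "x \<in> carrier M"
      and NT: "\<forall>x\<in>carrier M. \<forall>r\<in>?T. x \<triangleleft>\<^bsub>M\<^esub> r \<in> N"
    show "x \<in> N"
    proof (rule mem[OF N(1) x])
      show "p s \<triangleleft>\<^bsub>M\<^esub> g s x \<in> N" for s
      proof (cases "s \<in> S0")
        case True
        then show ?thesis
          using right_submoduleD(4)[OF N(1)] N(2) gc[OF x] by blast
      next
        case False
        then have "g s x \<in> ?T"
          using R.genideal_self[OF X] x by blast
        then show ?thesis
          using NT p by blast
      qed
    qed
  qed
  ultimately have T: "?T \<in> fg_quotient_ideals R M"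
    using fg_quotient_ideals_iff S0 p by (meson finite_imageI image_subsetI)
  have "?T \<subseteq> I" if I: "I \<in> fg_quotient_ideals R M" for I
  proof (rule R.genideal_minimal)
    show id: "ideal I R"
      using I fg_quotient_ideals_iff by blast
    interpret I: ideal I R by fact
    interpret reg: right_module R "regular_right_module R"
      by (rule R.regular_right_module)
    have Isub: "right_submodule R I (regular_right_module R)"
      by (rule reg.right_submoduleI) (auto simp: I.I_r_closed I.Icarr)
    have "g s x \<in> I" if s: "s \<notin> S0" and x: "x \<in> carrier M" for s x
    proof -
      let ?K = "{x \<in> carrier M. g s x \<in> I}"
      \<comment> \<open>The preimage of I under the coordinate g s contains S, where g s is zero,
        and contains MI, since g s (y r) = (g s y) r lies in I. As S generates M modulo I, it is all
        of M.\<close>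
      have "carrier M \<subseteq> ?K"
      proof (rule generates_moduloD[OF S(3)[OF I]])
        show "right_submodule R ?K M"
          by (rule right_submodule_vimage[OF R.regular_right_module g Isub])
        show "S \<subseteq> ?K"
        proof
          fix y assume "y \<in> S"
          moreover from this have "g s y = \<zero>"
            using s unfolding S0_def by blast
          ultimately show "y \<in> ?K"
            using S(2) by auto
        qed
        show "y \<triangleleft>\<^bsub>M\<^esub> r \<in> ?K" if "y \<in> carrier M" "r \<in> I" for y r
          using that g[of s] gc[of y s] I.I_l_closed I.Icarr by (auto simp: right_module_hom_def)
      qed
      then show ?thesis using x by blast
    qed
    then show "?X \<subseteq> I" by blast
  qed
  then show ?thesis
    using T by blast
qed

end

theorem proposition5p6:
  fixes R :: "('a, 'm) ring_scheme" and P :: "('a, 'b, 'n) rmod_scheme"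
  assumes "ring R"
    and "semilocal R"
    and "right_module R P"
    and "countably_generated R P"
    and "projective_right_module R P"
  shows "fair_sized R P"
proof -
  interpret right_module R P by fact
  obtain T where "T \<in> fg_quotient_ideals R P" "\<And>I. I \<in> fg_quotient_ideals R P \<Longrightarrow> T \<subseteq> I"
    using uniform_generators_modulo[OF assms(2)] projective_least_fg_quotient_ideal[OF assms(5)]
    by metis
  \<comment> \<open>A least element of the family is in particular minimal.\<close>
  then show ?thesis
    using assms unfolding fair_sized_def by blast
qed

end
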